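(* For a sequence $(\mu_n)_{n\ge1}$ of measures in $\mathcal{P}(\mathbb{R})$ and a measure $\mu^*\in\mathcal{P}(\mathbb{R})$ the following conditions are equivalent: (1) $\mu_n\rightharpoonup\mu^*$ and $J(\mu_n,\nu)\to J(\mu^*,\nu)$ for all $\nu\in\mathcal{P}(\mathbb{R})$; (2) $\mu_n\rightharpoonup\mu^*$ and there exists a measure $\nu_0\in\mathcal{P}(\mathbb{R})$ such that $J(\mu_n,\nu_0)\to J(\mu^*,\nu_0)<+\infty$; (3) $J(\mu_n,\mu^* )\to0$.
   Context: $g\colon\mathbb{R}\to\mathbb{R}$ is a strictly convex function that attains its minimum at $0$, with $g(0)=0$, and there exist constants $A,B\ge0$ such that $g(x-y)\le A+B(g(x)+g(y))$ for all $x,y\in\mathbb{R}$. $\mathcal{P}(\mathbb{R})$ is the set of Borel probability measures on $\mathbb{R}$, and $\rightharpoonup$ denotes weak convergence of probability measures. For $\mu\in\mathcal{P}(\mathbb{R})$, $F_\mu(x)=\mu((-\infty,x))$ and the quantile function is $F_\mu^{-1}(y)=\inf\{x\colon F_\mu(x)\ge y\}$ for $0<y<1$. The transportation cost is $$J(\mu,\nu) := \inf_{\gamma\in\Pi(\mu,\nu)}\int_{\mathbb{R}\times\mathbb{R}} g(x-y)\,d\gamma(x,y) = \int_0^1 g\bigl(F_\mu^{-1}(x)-F_\nu^{-1}(x)\bigr)\,dx\in[0,+\infty],$$ where $\Pi(\mu,\nu)$ is the set of probability measures on $\mathbb{R}^2$ with first marginal $\mu$ and second marginal $\nu$. Convergence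 of values of $J$ is understood in $[0,+\infty]$. *)

theory Defs
  imports "HOL-Probability.Probability"
begin

definition strictly_convex_on :: "'a::real_vector set \<Rightarrow> ('a \<Rightarrow> real) \<Rightarrow> bool"
  where "strictly_convex_on S f \<longleftrightarrow> convex S \<and>
    (\<forall>x\<in>S. \<forall>y\<in>S. \<forall>u>0. \<forall>v>0. x \<noteq> y \<longrightarrow> u + v = 1 \<longrightarrow>
      f (u *\<^sub>R x + v *\<^sub>R y) < u * f x + v * f y)"

definition transport_plans :: "real measure \<Rightarrow> real measure \<Rightarrow> (real \<times> real) measure set"
  where "transport_plans \<mu> \<nu> = {\<gamma>. prob_space \<gamma> \<and> sets \<gamma> = sets borel \<and>
    distr \<gamma> borel fst = \<mu> \<and> distr \<gamma> borel snd = \<nu>}"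

(* Intended for g \<ge> 0: ennreal sends negative reals to 0. *)
definition transport_cost :: "(real \<Rightarrow> real) \<Rightarrow> real measure \<Rightarrow> real measure \<Rightarrow> ennreal"
  where "transport_cost g \<mu> \<nu> =
    (INF \<gamma>\<in>transport_plans \<mu> \<nu>. \<integral>\<^sup>+(x, y). ennreal (g (x - y)) \<partial>\<gamma>)"

end

theory Submission
  imports Defs
begin

text \<open>
  The transportation cost on the line is attained by the coupling of the two quantile functions on
  \<open>(0, 1)\<close> (\<open>transport_cost_eq_quantile\<close>). The quantile function of a measure is the same whatever
  measure it is coupled with, so all measures of the theorem become random variables on one
  probability space: with \<open>X n\<close>, \<open>X'\<close> and \<open>Y\<close> the quantile functions of \<open>\<mu> n\<close>, \<open>\<mu>'\<close> and \<open>\<nu>\<close>, the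
  costs are the integrals of \<open>g (X n - Y)\<close>, \<open>g (X' - Y)\<close> and \<open>g (X n - X')\<close>, and weak convergence
  gives \<open>X n \<longlonglongrightarrow> X'\<close> almost everywhere (\<open>quantile_tendsto_AE\<close>).

  The equivalence is then a matter of exchanging the limit and the integral. Both \<open>X n - X' = (X n
  - Y) - (X' - Y)\<close> and \<open>X n - Y = (X n - X') - (Y - X')\<close> subtract a fixed variable of finite cost
  from a sequence whose costs converge. The growth condition on \<open>g\<close> bounds the cost of such a
  difference by a sequence with converging integrals, so a generalized dominated convergence
  theorem applies (\<open>cost_tendsto_of_shift\<close>). The first decomposition, with \<open>\<nu> = \<nu>\<^sub>0\<close>, leads from
  \<open>cond2\<close> to \<open>cond3\<close>, the second from \<open>cond3\<close> to \<open>cond1\<close> if the cost between \<open>\<mu>'\<close> and \<open>\<nu>\<close> is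
  finite; if it is infinite, Fatou's lemma gives the claim. Weak convergence follows from \<open>cond3\<close>
  because \<open>g\<close> is positive away from 0 and hence controls the \<open>L1\<close> distance of \<open>X n\<close> and \<open>X'\<close>.

  For the optimality of the quantile coupling, \<open>g\<close> is written as the integral of a monotone
  subgradient, and the subgradient as the integral of its level indicators. This presents the cost
  \<open>g (x - y)\<close>, for \<open>x > y\<close> (the other case is its mirror image), as a superposition of the costs
  \<open>1[x \<in> U, y \<in> D]\<close> with an up-set \<open>U\<close> and a down-set \<open>D\<close>. For a comonotone coupling the events \<open>x
  \<in> U\<close> and \<open>y \<in> D\<close> are disjoint or cover the whole space, so the probability of their intersection
  is the least that the marginals permit.
\<close>

section \<open>Convex functions of one variable\<close>

lemma strictly_convex_onD:
  assumes "strictly_convex_on S f" "x \<in> S" "y \<in> S" "x \<noteq> y" "0 < t" "t < 1"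
  shows "f ((1 - t) *\<^sub>R x + t *\<^sub>R y) < (1 - t) * f x + t * f y"
proof -
  have "\<forall>u>0. \<forall>v>0. u + v = 1 \<longrightarrow> f (u *\<^sub>R x + v *\<^sub>R y) < u * f x + v * f y"
    using assms(1-4) unfolding strictly_convex_on_def by blast
  with assms(5,6) show ?thesis by simp
qed

lemma strictly_convex_on_imp_convex_on:
  assumes "strictly_convex_on S f"
  shows "convex_on S f"
proof (rule convex_onI)
  show "convex S"
    using assms by (simp add: strictly_convex_on_def)
  fix t :: real and x y assume *: "0 < t" "t < 1" "x \<in> S" "y \<in> S"
  show "f ((1 - t) *\<^sub>R x + t *\<^sub>R y) \<le> (1 - t) * f x + t * f y"
  proof (cases "x = y")
    case True
    then show ?thesis
      by (simp add: scaleR_left_distrib[symmetric] distrib_right[symmetric])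
  next
    case False
    with strictly_convex_onD[OF assms] * show ?thesis
      by (simp add: less_imp_le)
  qed
qed

lemma strictly_convex_on_unique_min:
  fixes f :: "real \<Rightarrow> real"
  assumes f: "strictly_convex_on UNIV f" and min: "\<And>x. f a \<le> f x" and "x \<noteq> a"
  shows "f a < f x"
  using strictly_convex_onD[OF f, of a x "1/2"] min[of "(1 - 1/2) *\<^sub>R a + (1/2) *\<^sub>R x"] \<open>x \<noteq> a\<close> by auto

text \<open>
  At \<open>x\<close> take the right derivative, that is, the infimum of the slopes to the right of \<open>x\<close>.
  Monotonicity is forced by adding the subgradient inequalities at two points.
\<close>

lemma convex_has_subgradient:
  fixes g :: "real \<Rightarrow> real"
  assumes "convex_on UNIV g"
  obtains p where "\<And>x y. g x + p x * (y - x) \<le> g y" "mono p"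
proof -
  define p where "p x = Inf ((\<lambda>t. (g x - g t) / (x - t)) ` ({x<..} \<inter> UNIV))" for x
  have sub: "g x + p x * (y - x) \<le> g y" for x y
    unfolding p_def by (rule convex_le_Inf_differential[OF assms]) auto
  have "mono p"
  proof (rule monoI)
    fix x y :: real assume "x \<le> y"
    have "p x * (y - x) \<le> p y * (y - x)"
      using sub[of x y] sub[of y x] by (simp add: algebra_simps)
    with \<open>x \<le> y\<close> show "p x \<le> p y"
      by (cases "x = y") auto
  qed
  with sub show ?thesis using that by blast
qed

text \<open>
  Along the partition of \<open>[0, t]\<close> into \<open>n\<close> equal parts the bounds on the increments telescope to
  \<open>(q t - q 0) * t / n\<close>, which tends to 0.  In the
  application \<open>q\<close> is a subgradient and jumps at the kinks of a convex function, where \<open>D\<close> has no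
  evident derivative; hence partitions instead of the mean value theorem.
\<close>

lemma eq_of_small_increments:
  fixes D q :: "real \<Rightarrow> real"
  assumes "0 \<le> t"
    and incr: "\<And>x y. 0 \<le> x \<Longrightarrow> x \<le> y \<Longrightarrow> y \<le> t \<Longrightarrow> \<bar>D y - D x\<bar> \<le> (q y - q x) * (y - x)"
  shows "D t = D 0"
proof -
  have bound: "\<bar>D t - D 0\<bar> \<le> (q t - q 0) * t / real n" if "0 < n" for n :: nat
  proof -
    define a where "a i = t * real i / real n" for i
    have step: "a (Suc i) - a i = t / real n" for i
      by (simp add: a_def ring_distribs add_divide_distrib)
    have "\<bar>D (a n) - D (a 0)\<bar> = \<bar>\<Sum>i<n. D (a (Suc i)) - D (a i)\<bar>"
      by (simp only: sum_lessThan_telescope[of "\<lambda>i. D (a i)"])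
    also have "\<dots> \<le> (\<Sum>i<n. \<bar>D (a (Suc i)) - D (a i)\<bar>)"
      by (rule sum_abs)
    also have "\<dots> \<le> (\<Sum>i<n. (q (a (Suc i)) - q (a i)) * (t / real n))"
    proof (rule sum_mono)
      fix i assume "i \<in> {..<n}"
      then have "t * real (Suc i) \<le> t * real n"
        using \<open>0 \<le> t\<close> by (intro mult_left_mono) auto
      then have "0 \<le> a i" "a i \<le> a (Suc i)" "a (Suc i) \<le> t"
        using \<open>0 \<le> t\<close> \<open>0 < n\<close> by (auto simp: a_def divide_simps algebra_simps)
      from incr[OF this] show "\<bar>D (a (Suc i)) - D (a i)\<bar> \<le> (q (a (Suc i)) - q (a i)) * (t / real n)"
        by (simp add: step)
    qed
    also have "\<dots> = (q (a n) - q (a 0)) * (t / real n)"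
      by (simp only: sum_distrib_right[symmetric] sum_lessThan_telescope[of "\<lambda>i. q (a i)"])
    finally show ?thesis
      using that by (simp add: a_def)
  qed
  have "(\<lambda>n. (q t - q 0) * t / real n) \<longlonglongrightarrow> 0"
    by (rule lim_const_over_n)
  then have "\<bar>D t - D 0\<bar> \<le> 0"
    by (rule LIMSEQ_le_const) (use bound in \<open>auto intro!: exI[of _ 1]\<close>)
  then show ?thesis by simp
qed

text \<open>
  A convex function is the integral of any of its subgradients: on \<open>[x, y]\<close> both \<open>g\<close> and the
  integral of \<open>p\<close> increase by something between \<open>p x * (y - x)\<close> and \<open>p y * (y - x)\<close>, so their
  difference satisfies the hypothesis of \<open>eq_of_small_increments\<close>.
\<close>

lemma convex_eq_integral_subgradient:
  fixes g p :: "real \<Rightarrow> real"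
  assumes sub: "\<And>x y. g x + p x * (y - x) \<le> g y" and "mono p" and "0 \<le> t"
  shows "(p has_integral (g t - g 0)) {0..t}"
proof -
  define P where "P s = integral {0..s} p" for s
  have int: "p integrable_on {a..b}" for a b
    by (rule integrable_on_mono_on) (use \<open>mono p\<close> in \<open>auto simp: mono_on_def mono_def\<close>)
  have "(g t - P t) = (g 0 - P 0)"
  proof (rule eq_of_small_increments[OF \<open>0 \<le> t\<close>, where q = p])
    fix x y :: real assume xy: "0 \<le> x" "x \<le> y" "y \<le> t"
    have "P x + integral {x..y} p = P y"
      unfolding P_def using xy by (intro Henstock_Kurzweil_Integration.integral_combine int) auto
    moreover have "integral {x..y} (\<lambda>_. p x) \<le> integral {x..y} p"
      by (rule integral_le) (use int \<open>mono p\<close> in \<open>auto simp: mono_def\<close>)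
    moreover have "integral {x..y} p \<le> integral {x..y} (\<lambda>_. p y)"
      by (rule integral_le) (use int \<open>mono p\<close> in \<open>auto simp: mono_def\<close>)
    ultimately show "\<bar>(g y - P y) - (g x - P x)\<bar> \<le> (p y - p x) * (y - x)"
      using sub[of x y] sub[of y x] xy by (simp add: algebra_simps abs_le_iff)
  qed
  then have "integral {0..t} p = g t - g 0"
    by (simp add: P_def)
  with int[of 0 t] show ?thesis
    by (metis integrable_integral)
qed

text \<open>
  The cost of moving \<open>x\<close> to a point \<open>y\<close> on its left is \<open>\<integral> p (u - y) du\<close> over \<open>{y<..<x}\<close>, and
  \<open>p (u - y)\<close> is in turn the length of \<open>{0..<p (u - y)}\<close>.  So the cost is the area of a set of pairs
  \<open>w = (u, v)\<close>.  What matters is the shape of the integrand: for fixed \<open>w\<close> it is the product of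
  the indicator of an up-set in \<open>x\<close> and the indicator of a set in \<open>y\<close> that is a down-set because
  \<open>p\<close> is monotone.
\<close>

lemma convex_nonneg_layer_cake:
  fixes g p :: "real \<Rightarrow> real"
  assumes sub: "\<And>x y. g x + p x * (y - x) \<le> g y" and p: "mono p"
    and g0: "g 0 = 0" and nonneg: "\<And>x. 0 \<le> g x"
  shows "(\<integral>\<^sup>+w. indicator {fst w<..} x
        * indicator {y. y < fst w \<and> 0 \<le> snd w \<and> snd w < p (fst w - y)} y \<partial>(lborel \<Otimes>\<^sub>M lborel))
    = (if y < x then ennreal (g (x - y)) else 0)" (is "(\<integral>\<^sup>+w. ?f w \<partial>_) = _")
proof -
  have [measurable]: "p \<in> borel_measurable borel"
    by (rule borel_measurable_mono[OF p])
  have p_nonneg: "0 \<le> p s" if "0 < s" for s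
  proof -
    have "0 \<le> p s * s"
      using sub[of s 0] nonneg[of s] g0 by simp
    with that show ?thesis
      by (simp add: zero_le_mult_iff)
  qed
  have [measurable]: "?f \<in> borel_measurable (lborel \<Otimes>\<^sub>M lborel)"
    unfolding indicator_def greaterThan_iff mem_Collect_eq by measurable
  have "(\<integral>\<^sup>+w. ?f w \<partial>(lborel \<Otimes>\<^sub>M lborel)) = (\<integral>\<^sup>+u. \<integral>\<^sup>+v. ?f (u, v) \<partial>lborel \<partial>lborel)"
    by (rule lborel.nn_integral_fst[symmetric]) measurable
  also have "\<dots> = (\<integral>\<^sup>+u. indicator {y<..<x} u * ennreal (p (u - y)) \<partial>lborel)"
  proof (rule nn_integral_cong)
    fix u
    have "(\<integral>\<^sup>+v. ?f (u, v) \<partial>lborel) = (\<integral>\<^sup>+v. indicator {y<..<x} u * indicator {0..<p (u - y)} v \<partial>lborel)"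
      by (intro nn_integral_cong) (auto split: split_indicator)
    also have "\<dots> = indicator {y<..<x} u * ennreal (p (u - y))"
      by (subst nn_integral_cmult) (auto split: split_indicator simp: p_nonneg)
    finally show "(\<integral>\<^sup>+v. ?f (u, v) \<partial>lborel) = \<dots>" .
  qed
  also have "\<dots> = (if y < x then ennreal (g (x - y)) else 0)"
  proof (cases "y < x")
    case True
    have "(\<integral>\<^sup>+u. indicator {y<..<x} u * ennreal (p (u - y)) \<partial>lborel)
       = (\<integral>\<^sup>+s. indicator {y<..<x} (y + 1 * s) * ennreal (p ((y + 1 * s) - y)) \<partial>lborel)"
      by (subst nn_integral_real_affine[where c=1 and t=y]) auto
    also have "\<dots> = (\<integral>\<^sup>+s. ennreal (p s) * indicator {0<..<x - y} s \<partial>lborel)"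
      by (intro nn_integral_cong) (auto split: split_indicator)
    also have "\<dots> = ennreal (g (x - y))"
    proof (rule nn_integral_has_integral_lebesgue')
      have "(p has_integral g (x - y)) {0..x - y}"
        using convex_eq_integral_subgradient[OF sub p, of "x - y"] True g0 by simp
      then show "(p has_integral g (x - y)) {0<..<x - y}"
        by (simp add: has_integral_Icc_iff_Ioo)
    qed (use p_nonneg in auto)
    finally show ?thesis using True by simp
  qed auto
  finally show ?thesis .
qed

section \<open>Optimality of comonotone couplings\<close>

definition comonotone_on :: "'a set \<Rightarrow> ('a \<Rightarrow> real) \<Rightarrow> ('a \<Rightarrow> real) \<Rightarrow> bool"
  where "comonotone_on S X Y \<longleftrightarrow> (\<forall>s\<in>S. \<forall>t\<in>S. X s < X t \<longrightarrow> Y s \<le> Y t)"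

lemma comonotone_on_sym: "comonotone_on S X Y \<Longrightarrow> comonotone_on S Y X"
  unfolding comonotone_on_def by (meson not_le)

definition up_closed :: "real set \<Rightarrow> bool"
  where "up_closed U \<longleftrightarrow> (\<forall>x\<in>U. \<forall>y\<ge>x. y \<in> U)"

definition down_closed :: "real set \<Rightarrow> bool"
  where "down_closed D \<longleftrightarrow> (\<forall>x\<in>D. \<forall>y\<le>x. y \<in> D)"

text \<open>
  By inclusion and exclusion, \<open>Q (A' \<inter> B') \<ge> Q A' + Q B' - 1\<close> always holds.  If \<open>A\<close> and \<open>B\<close> are disjoint
  or cover the space, then \<open>P (A \<inter> B)\<close> is the smallest value that these bounds leave possible.
\<close>

lemma emeasure_Int_le_of_disjoint_or_cover:
  assumes P: "prob_space P" and Q: "prob_space Q"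
    and A: "A \<in> sets P" "B \<in> sets P" and A': "A' \<in> sets Q" "B' \<in> sets Q"
    and eq: "emeasure P A = emeasure Q A'" "emeasure P B = emeasure Q B'"
    and disj: "A \<inter> B = {} \<or> space P \<subseteq> A \<union> B"
  shows "emeasure P (A \<inter> B) \<le> emeasure Q (A' \<inter> B')"
proof -
  interpret P: prob_space P by fact
  interpret Q: prob_space Q by fact
  from disj show ?thesis
  proof
    assume "space P \<subseteq> A \<union> B"
    with A have "A \<union> B = space P"
      using sets.sets_into_space by blast
    then have "P.prob (A \<inter> B) = P.prob A + P.prob B - 1"
      using measure_Un3[of A P B] A by (simp add: P.fmeasurable_eq_sets P.prob_space)
    also have "\<dots> = Q.prob A' + Q.prob B' - 1"
      using eq by (simp add: measure_def)
    also have "\<dots> \<le> Q.prob (A' \<inter> B')"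
      using measure_Un3[of A' Q B'] A' Q.prob_le_1[of "A' \<union> B'"]
      by (simp add: Q.fmeasurable_eq_sets)
    finally show ?thesis
      by (simp add: P.emeasure_eq_measure Q.emeasure_eq_measure)
  qed simp
qed

text \<open>
  If \<open>s\<close> satisfied both \<open>X s \<in> U\<close> and \<open>Y s \<in> D\<close> while \<open>t\<close> satisfied neither, then \<open>X t < X s\<close> and
  \<open>Y s < Y t\<close>, against comonotonicity.  Hence the two events are disjoint or cover the space.
\<close>

lemma comonotone_up_down_le:
  assumes P: "prob_space P" and Q: "prob_space Q"
    and X[measurable]: "X \<in> borel_measurable P" and Y[measurable]: "Y \<in> borel_measurable P"
    and X'[measurable]: "X' \<in> borel_measurable Q" and Y'[measurable]: "Y' \<in> borel_measurable Q"
    and dX: "distr P borel X = distr Q borel X'" and dY: "distr P borel Y = distr Q borel Y'"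
    and com: "comonotone_on (space P) X Y"
    and U[measurable]: "U \<in> sets borel" and D[measurable]: "D \<in> sets borel"
    and "up_closed U" "down_closed D"
  shows "(\<integral>\<^sup>+\<omega>. indicator U (X \<omega>) * indicator D (Y \<omega>) \<partial>P)
    \<le> (\<integral>\<^sup>+\<omega>. indicator U (X' \<omega>) * indicator D (Y' \<omega>) \<partial>Q)"
proof -
  let ?A = "X -` U \<inter> space P" and ?B = "Y -` D \<inter> space P"
  let ?A' = "X' -` U \<inter> space Q" and ?B' = "Y' -` D \<inter> space Q"
  have "?A \<inter> ?B = {} \<or> space P \<subseteq> ?A \<union> ?B"
  proof (rule ccontr)
    assume "\<not> ?thesis"
    then obtain s t where st: "s \<in> space P" "t \<in> space P" "X s \<in> U" "Y s \<in> D" "X t \<notin> U" "Y t \<notin> D"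
      by auto
    then have "X t < X s" "Y s < Y t"
      using \<open>up_closed U\<close> \<open>down_closed D\<close> unfolding up_closed_def down_closed_def
      by (meson not_le)+
    with com st show False
      unfolding comonotone_on_def by force
  qed
  moreover have "emeasure P ?A = emeasure Q ?A'"
    using arg_cong[OF dX, of "\<lambda>M. emeasure M U"] by (simp add: emeasure_distr)
  moreover have "emeasure P ?B = emeasure Q ?B'"
    using arg_cong[OF dY, of "\<lambda>M. emeasure M D"] by (simp add: emeasure_distr)
  ultimately have "emeasure P (?A \<inter> ?B) \<le> emeasure Q (?A' \<inter> ?B')"
    by (intro emeasure_Int_le_of_disjoint_or_cover P Q) auto
  moreover have "(\<integral>\<^sup>+\<omega>. indicator U (X \<omega>) * indicator D (Y \<omega>) \<partial>P) = emeasure P (?A \<inter> ?B)"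
    by (subst nn_integral_indicator[symmetric], simp)
       (rule nn_integral_cong, auto split: split_indicator)
  moreover have "(\<integral>\<^sup>+\<omega>. indicator U (X' \<omega>) * indicator D (Y' \<omega>) \<partial>Q) = emeasure Q (?A' \<inter> ?B')"
    by (subst nn_integral_indicator[symmetric], simp)
       (rule nn_integral_cong, auto split: split_indicator)
  ultimately show ?thesis by simp
qed

text \<open>
  Costs that are superpositions of the elementary costs of the preceding lemma inherit its
  inequality, by exchanging the order of integration.
\<close>

lemma comonotone_superposition_le:
  fixes c :: "real \<Rightarrow> real \<Rightarrow> ennreal" and N :: "'c measure"
  assumes P: "prob_space P" and Q: "prob_space Q" and N: "sigma_finite_measure N"
    and X[measurable]: "X \<in> borel_measurable P" and Y[measurable]: "Y \<in> borel_measurable P"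
    and X'[measurable]: "X' \<in> borel_measurable Q" and Y'[measurable]: "Y' \<in> borel_measurable Q"
    and dX: "distr P borel X = distr Q borel X'" and dY: "distr P borel Y = distr Q borel Y'"
    and com: "comonotone_on (space P) X Y"
    and U[measurable]: "{z \<in> space (borel \<Otimes>\<^sub>M N). fst z \<in> U (snd z)} \<in> sets (borel \<Otimes>\<^sub>M N)"
    and D[measurable]: "{z \<in> space (borel \<Otimes>\<^sub>M N). fst z \<in> D (snd z)} \<in> sets (borel \<Otimes>\<^sub>M N)"
    and up: "\<And>w. up_closed (U w)" and down: "\<And>w. down_closed (D w)"
    and c: "\<And>x y. c x y = (\<integral>\<^sup>+w. indicator (U w) x * indicator (D w) y \<partial>N)"
  shows "(\<integral>\<^sup>+\<omega>. c (X \<omega>) (Y \<omega>) \<partial>P) \<le> (\<integral>\<^sup>+\<omega>. c (X' \<omega>) (Y' \<omega>) \<partial>Q)"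
proof -
  have ind: "(\<lambda>z. indicator (U (snd z)) (fst z) :: ennreal) \<in> borel_measurable (borel \<Otimes>\<^sub>M N)"
    "(\<lambda>z. indicator (D (snd z)) (fst z) :: ennreal) \<in> borel_measurable (borel \<Otimes>\<^sub>M N)"
    unfolding indicator_def by measurable
  have swap: "(\<integral>\<^sup>+\<omega>. c (Z \<omega>) (W \<omega>) \<partial>R) = (\<integral>\<^sup>+w. \<integral>\<^sup>+\<omega>. indicator (U w) (Z \<omega>) * indicator (D w) (W \<omega>) \<partial>R \<partial>N)"
    if "prob_space R" and [measurable]: "Z \<in> borel_measurable R" "W \<in> borel_measurable R" for R :: "'d measure" and Z W
  proof -
    interpret R: prob_space R by fact
    interpret N: sigma_finite_measure N by fact
    interpret pair_sigma_finite R N ..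
    have [measurable]: "(\<lambda>z. indicator (U (snd z)) (Z (fst z)) :: ennreal) \<in> borel_measurable (R \<Otimes>\<^sub>M N)"
      using measurable_compose[OF _ ind(1), of "\<lambda>z. (Z (fst z), snd z)" "R \<Otimes>\<^sub>M N"] by simp
    have [measurable]: "(\<lambda>z. indicator (D (snd z)) (W (fst z)) :: ennreal) \<in> borel_measurable (R \<Otimes>\<^sub>M N)"
      using measurable_compose[OF _ ind(2), of "\<lambda>z. (W (fst z), snd z)" "R \<Otimes>\<^sub>M N"] by simp
    show ?thesis unfolding c
      by (rule Fubini'[symmetric]) (simp add: split_beta')
  qed
  have "(\<integral>\<^sup>+\<omega>. indicator (U w) (X \<omega>) * indicator (D w) (Y \<omega>) \<partial>P)
      \<le> (\<integral>\<^sup>+\<omega>. indicator (U w) (X' \<omega>) * indicator (D w) (Y' \<omega>) \<partial>Q)" if w: "w \<in> space N" for w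
  proof (rule comonotone_up_down_le[OF P Q X Y X' Y' dX dY com])
    have "(\<lambda>x. (x, w)) -` {z \<in> space (borel \<Otimes>\<^sub>M N). fst z \<in> U (snd z)} \<inter> space borel \<in> sets borel"
      by (rule measurable_sets[OF _ U]) (use w in measurable)
    also have "(\<lambda>x. (x, w)) -` {z \<in> space (borel \<Otimes>\<^sub>M N). fst z \<in> U (snd z)} \<inter> space borel = U w"
      using w by (auto simp: space_pair_measure)
    finally show "U w \<in> sets borel" .
    have "(\<lambda>x. (x, w)) -` {z \<in> space (borel \<Otimes>\<^sub>M N). fst z \<in> D (snd z)} \<inter> space borel \<in> sets borel"
      by (rule measurable_sets[OF _ D]) (use w in measurable)
    also have "(\<lambda>x. (x, w)) -` {z \<in> space (borel \<Otimes>\<^sub>M N). fst z \<in> D (snd z)} \<inter> space borel = D w"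
      using w by (auto simp: space_pair_measure)
    finally show "D w \<in> sets borel" .
  qed (use up down in auto)
  then show ?thesis
    unfolding swap[OF P X Y] swap[OF Q X' Y'] by (rule nn_integral_mono)
qed

text \<open>
  The layer cake presents the cost of moving to the left as a superposition over pairs
  \<open>w = (u, v)\<close>, with the up-sets \<open>U w\<close> and the down-sets \<open>D w\<close> defined below.
\<close>

lemma comonotone_positive_part_le:
  fixes g :: "real \<Rightarrow> real"
  assumes g: "convex_on UNIV g" "g 0 = 0" "\<And>x. 0 \<le> g x"
    and P: "prob_space P" and Q: "prob_space Q"
    and X: "X \<in> borel_measurable P" and Y: "Y \<in> borel_measurable P"
    and X': "X' \<in> borel_measurable Q" and Y': "Y' \<in> borel_measurable Q"
    and dX: "distr P borel X = distr Q borel X'" and dY: "distr P borel Y = distr Q borel Y'"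
    and com: "comonotone_on (space P) X Y"
  shows "(\<integral>\<^sup>+\<omega>. (if Y \<omega> < X \<omega> then ennreal (g (X \<omega> - Y \<omega>)) else 0) \<partial>P)
    \<le> (\<integral>\<^sup>+\<omega>. (if Y' \<omega> < X' \<omega> then ennreal (g (X' \<omega> - Y' \<omega>)) else 0) \<partial>Q)"
proof -
  obtain p where p: "\<And>x y. g x + p x * (y - x) \<le> g y" "mono p"
    using convex_has_subgradient[OF g(1)] by blast
  have [measurable]: "p \<in> borel_measurable borel"
    by (rule borel_measurable_mono[OF p(2)])
  define U where "U w = {fst w<..}" for w :: "real \<times> real"
  define D where "D w = {y. y < fst w \<and> 0 \<le> snd w \<and> snd w < p (fst w - y)}" for w
  show ?thesis
  proof (rule comonotone_superposition_le[OF P Q _ X Y X' Y' dX dY com, where U = U and D = D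
        and N = "lborel \<Otimes>\<^sub>M lborel" and c = "\<lambda>x y. if y < x then ennreal (g (x - y)) else 0"])
    show "sigma_finite_measure (lborel \<Otimes>\<^sub>M lborel :: (real \<times> real) measure)"
      by (rule sigma_finite_pair_measure) unfold_locales
    show "{z \<in> space (borel \<Otimes>\<^sub>M (lborel \<Otimes>\<^sub>M lborel)). fst z \<in> U (snd z)} \<in> sets (borel \<Otimes>\<^sub>M (lborel \<Otimes>\<^sub>M lborel))"
      unfolding U_def greaterThan_iff by measurable
    show "{z \<in> space (borel \<Otimes>\<^sub>M (lborel \<Otimes>\<^sub>M lborel)). fst z \<in> D (snd z)} \<in> sets (borel \<Otimes>\<^sub>M (lborel \<Otimes>\<^sub>M lborel))"
      unfolding D_def mem_Collect_eq by measurable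
    show "up_closed (U w)" for w
      by (auto simp: U_def up_closed_def)
    show "down_closed (D w)" for w
      unfolding D_def down_closed_def
    proof (intro ballI allI impI)
      fix x y assume x: "x \<in> {y. y < fst w \<and> 0 \<le> snd w \<and> snd w < p (fst w - y)}" and "y \<le> x"
      then have "p (fst w - x) \<le> p (fst w - y)"
        by (intro monoD[OF p(2)]) auto
      with x \<open>y \<le> x\<close> show "y \<in> {y. y < fst w \<and> 0 \<le> snd w \<and> snd w < p (fst w - y)}"
        by simp
    qed
    show "(if y < x then ennreal (g (x - y)) else 0) = (\<integral>\<^sup>+w. indicator (U w) x * indicator (D w) y \<partial>(lborel \<Otimes>\<^sub>M lborel))" for x y
      unfolding U_def D_def by (rule convex_nonneg_layer_cake[OF p g(2,3), symmetric])
  qed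
qed

text \<open>
  The cost splits into the part where mass moves to the left and the part where it moves to the
  right.  The second is of the same form as the first for the cost \<open>g (- x)\<close>, with the roles of
  the two variables exchanged.
\<close>

lemma comonotone_coupling_optimal:
  fixes g :: "real \<Rightarrow> real"
  assumes g: "convex_on UNIV g" "g 0 = 0" "\<And>x. 0 \<le> g x"
    and P: "prob_space P" and Q: "prob_space Q"
    and X[measurable]: "X \<in> borel_measurable P" and Y[measurable]: "Y \<in> borel_measurable P"
    and X'[measurable]: "X' \<in> borel_measurable Q" and Y'[measurable]: "Y' \<in> borel_measurable Q"
    and dX: "distr P borel X = distr Q borel X'" and dY: "distr P borel Y = distr Q borel Y'"
    and com: "comonotone_on (space P) X Y"
  shows "(\<integral>\<^sup>+\<omega>. ennreal (g (X \<omega> - Y \<omega>)) \<partial>P) \<le> (\<integral>\<^sup>+\<omega>. ennreal (g (X' \<omega> - Y' \<omega>)) \<partial>Q)"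
proof -
  have [measurable]: "g \<in> borel_measurable borel"
    by (intro borel_measurable_continuous_onI convex_on_continuous g) auto
  have g': "convex_on UNIV (\<lambda>x. g (- x))"
  proof (rule convex_onI)
    fix t x y :: real assume "0 < t" "t < 1"
    with convex_onD[OF g(1), of t "- x" "- y"]
    show "g (- ((1 - t) *\<^sub>R x + t *\<^sub>R y)) \<le> (1 - t) * g (- x) + t * g (- y)"
      by (simp add: algebra_simps)
  qed simp
  have split: "(\<integral>\<^sup>+\<omega>. ennreal (g (Z \<omega> - W \<omega>)) \<partial>R)
      = (\<integral>\<^sup>+\<omega>. (if W \<omega> < Z \<omega> then ennreal (g (Z \<omega> - W \<omega>)) else 0) \<partial>R)
      + (\<integral>\<^sup>+\<omega>. (if Z \<omega> < W \<omega> then ennreal (g (- (W \<omega> - Z \<omega>))) else 0) \<partial>R)"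
    if [measurable]: "Z \<in> borel_measurable R" "W \<in> borel_measurable R" for R :: "'d measure" and Z W
    using g(2) by (subst nn_integral_add[symmetric]) (auto intro!: nn_integral_cong simp: not_less antisym_conv)
  show ?thesis
    unfolding split[OF X Y] split[OF X' Y']
    by (intro add_mono comonotone_positive_part_le[OF g P Q X Y X' Y' dX dY com]
      comonotone_positive_part_le[OF g' _ _ P Q Y X Y' X' dY dX comonotone_on_sym[OF com]])
     (use g in auto)
qed

section \<open>The quantile formula for the transportation cost\<close>

definition uniform01 :: "real measure"
  where "uniform01 = restrict_space lborel {0<..<1}"

lemma prob_space_uniform01: "prob_space uniform01"
  by (auto simp: uniform01_def emeasure_restrict_space space_restrict_space intro!: prob_spaceI)

lemma space_uniform01 [simp]: "space uniform01 = {0<..<1}"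
  by (simp add: uniform01_def space_restrict_space)

definition quantile :: "real measure \<Rightarrow> real \<Rightarrow> real"
  where "quantile M \<omega> = Inf {x. \<omega> \<le> cdf M x}"

context
  fixes M :: "real measure"
  assumes M: "real_distribution M"
begin

interpretation cdf_distribution M
  unfolding cdf_distribution_def by (rule M)

lemma quantile_le_iff:
  assumes "\<omega> \<in> {0<..<1}"
  shows "quantile M \<omega> \<le> x \<longleftrightarrow> \<omega> \<le> cdf M x"
  using pseudoinverse[of \<omega> x] assms by (simp add: quantile_def)

lemma quantile_mono: "mono_on {0<..<1} (quantile M)"
  using mono_I unfolding quantile_def .

lemma quantile_measurable [measurable]: "quantile M \<in> borel_measurable uniform01"
proof -
  have "quantile M \<in> borel_measurable (restrict_space borel {0<..<1})"
    using measurable_CI unfolding quantile_def .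
  then show ?thesis
    unfolding uniform01_def by (simp cong: measurable_cong_sets add: sets_restrict_space)
qed

lemma distr_quantile: "distr uniform01 borel (quantile M) = M"
  using distr_I_eq_M unfolding quantile_def uniform01_def .

end

lemma comonotone_quantiles:
  assumes "real_distribution M" "real_distribution N"
  shows "comonotone_on {0<..<1} (quantile M) (quantile N)"
  unfolding comonotone_on_def
proof (intro ballI impI)
  fix s t assume st: "s \<in> {0<..<1::real}" "t \<in> {0<..<1::real}" "quantile M s < quantile M t"
  then have "s \<le> t"
    using quantile_mono[OF assms(1)] unfolding mono_on_def by (meson not_le linear)
  with st show "quantile N s \<le> quantile N t"
    using quantile_mono[OF assms(2)] unfolding mono_on_def by blast
qed

text \<open>
  The two quantile functions, on \<open>(0, 1)\<close> with Lebesgue measure, are comonotone because both are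
  nondecreasing.  Their joint law is a transport plan, and it is optimal among all plans.
\<close>

theorem transport_cost_eq_quantile:
  fixes g :: "real \<Rightarrow> real"
  assumes g: "convex_on UNIV g" "g 0 = 0" "\<And>x. 0 \<le> g x"
    and M: "real_distribution M" and N: "real_distribution N"
  shows "transport_cost g M N = (\<integral>\<^sup>+\<omega>. ennreal (g (quantile M \<omega> - quantile N \<omega>)) \<partial>uniform01)"
proof (rule antisym)
  note [measurable] = quantile_measurable[OF M] quantile_measurable[OF N]
  have [measurable]: "g \<in> borel_measurable borel"
    by (intro borel_measurable_continuous_onI convex_on_continuous g) auto
  let ?\<gamma> = "distr uniform01 borel (\<lambda>\<omega>. (quantile M \<omega>, quantile N \<omega>))"
  have fst_snd: "(fst :: real \<times> real \<Rightarrow> real) \<in> borel_measurable borel" "(snd :: real \<times> real \<Rightarrow> real) \<in> borel_measurable borel"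
    by (auto intro!: borel_measurable_continuous_onI continuous_on_fst continuous_on_snd)
  have pair [measurable]: "(\<lambda>\<omega>. (quantile M \<omega>, quantile N \<omega>)) \<in> measurable uniform01 (borel :: (real \<times> real) measure)"
    unfolding borel_prod[symmetric] by measurable
  have "distr ?\<gamma> borel fst = M" "distr ?\<gamma> borel snd = N"
    by (simp_all add: distr_distr[OF _ pair] fst_snd comp_def distr_quantile M N)
  then have "?\<gamma> \<in> transport_plans M N"
    unfolding transport_plans_def
    by (auto intro!: prob_space.prob_space_distr[OF prob_space_uniform01])
  moreover have "(\<integral>\<^sup>+(x, y). ennreal (g (x - y)) \<partial>?\<gamma>)
      = (\<integral>\<^sup>+\<omega>. ennreal (g (quantile M \<omega> - quantile N \<omega>)) \<partial>uniform01)"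
    by (subst nn_integral_distr) (auto simp: borel_prod[symmetric] split_beta')
  ultimately show "transport_cost g M N \<le> (\<integral>\<^sup>+\<omega>. ennreal (g (quantile M \<omega> - quantile N \<omega>)) \<partial>uniform01)"
    unfolding transport_cost_def by (metis (no_types, lifting) INF_lower)
  show "(\<integral>\<^sup>+\<omega>. ennreal (g (quantile M \<omega> - quantile N \<omega>)) \<partial>uniform01) \<le> transport_cost g M N"
    unfolding transport_cost_def
  proof (rule INF_greatest)
    fix \<gamma> assume "\<gamma> \<in> transport_plans M N"
    then have \<gamma>: "prob_space \<gamma>" "sets \<gamma> = sets borel" "distr \<gamma> borel fst = M" "distr \<gamma> borel snd = N"
      by (auto simp: transport_plans_def)
    have [measurable]: "fst \<in> borel_measurable \<gamma>" "snd \<in> borel_measurable \<gamma>"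
      unfolding measurable_cong_sets[OF \<gamma>(2) refl] by (rule fst_snd)+
    have "(\<integral>\<^sup>+\<omega>. ennreal (g (quantile M \<omega> - quantile N \<omega>)) \<partial>uniform01)
        \<le> (\<integral>\<^sup>+z. ennreal (g (fst z - snd z)) \<partial>\<gamma>)"
      by (rule comonotone_coupling_optimal[OF g prob_space_uniform01 \<gamma>(1)])
         (auto simp: distr_quantile M N \<gamma> comonotone_quantiles)
    then show "(\<integral>\<^sup>+\<omega>. ennreal (g (quantile M \<omega> - quantile N \<omega>)) \<partial>uniform01)
        \<le> (\<integral>\<^sup>+(x, y). ennreal (g (x - y)) \<partial>\<gamma>)"
      by (simp add: split_beta')
  qed
qed

section \<open>Limit theorems\<close>

text \<open>
  Quantile functions converge wherever the limiting quantile function is continuous, and a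
  monotone function has only countably many discontinuities.
\<close>

lemma quantile_tendsto_AE:
  assumes \<mu>: "\<And>n. real_distribution (\<mu> n)" and M: "real_distribution M"
    and weak: "weak_conv_m \<mu> M"
  shows "AE \<omega> in uniform01. (\<lambda>n. quantile (\<mu> n) \<omega>) \<longlonglongrightarrow> quantile M \<omega>"
proof -
  interpret M: real_distribution M by (rule M)
  let ?D = "{\<omega> \<in> {0<..<1}. \<not> isCont (quantile M) \<omega>}"
  have conv: "(\<lambda>n. cdf (\<mu> n) x) \<longlonglongrightarrow> cdf M x" if "measure M {x} = 0" for x
    using weak that M.isCont_cdf by (auto simp: weak_conv_m_def weak_conv_def)
  have between: "\<exists>x. a < x \<and> x < b \<and> measure M {x} = 0" if "a < b" for a b :: real
    using open_minus_countable[OF M.countable_support, of "{a<..<b}"] that by auto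
  have "(\<lambda>n. quantile (\<mu> n) \<omega>) \<longlonglongrightarrow> quantile M \<omega>"
    if \<omega>: "\<omega> \<in> {0<..<1}" and cont: "isCont (quantile M) \<omega>" for \<omega>
  proof (rule order_tendstoI)
    fix a assume "a < quantile M \<omega>"
    then obtain x where x: "a < x" "x < quantile M \<omega>" "measure M {x} = 0"
      using between by blast
    then have "cdf M x < \<omega>"
      using quantile_le_iff[OF M \<omega>] by (meson not_le)
    with conv[OF x(3)] have "\<forall>\<^sub>F n in sequentially. cdf (\<mu> n) x < \<omega>"
      by (rule order_tendstoD)
    then show "\<forall>\<^sub>F n in sequentially. a < quantile (\<mu> n) \<omega>"
      by eventually_elim (use x(1) quantile_le_iff[OF \<mu> \<omega>] in \<open>meson less_trans not_le\<close>)
  next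
    fix b assume "quantile M \<omega> < b"
    with cont have "\<forall>\<^sub>F s in at \<omega>. quantile M s < b"
      unfolding isCont_def by (rule order_tendstoD)
    then have "\<forall>\<^sub>F s in at_right \<omega>. quantile M s < b"
      unfolding eventually_at_split by simp
    moreover have "\<forall>\<^sub>F s in at_right \<omega>. \<omega> < s \<and> s < 1"
      using \<omega> by (auto simp: eventually_at_right)
    ultimately have "\<forall>\<^sub>F s in at_right \<omega>. quantile M s < b \<and> \<omega> < s \<and> s < 1"
      by eventually_elim auto
    from eventually_happens'[OF trivial_limit_at_right_real this]
    obtain s where s: "quantile M s < b" "\<omega> < s" "s < 1"
      by blast
    then obtain x where x: "quantile M s < x" "x < b" "measure M {x} = 0"
      using between by blast
    then have "\<omega> < cdf M x"
      using quantile_le_iff[OF M, of s x] s \<omega> by auto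
    with conv[OF x(3)] have "\<forall>\<^sub>F n in sequentially. \<omega> < cdf (\<mu> n) x"
      by (rule order_tendstoD)
    then show "\<forall>\<^sub>F n in sequentially. quantile (\<mu> n) \<omega> < b"
      by eventually_elim (use x(2) quantile_le_iff[OF \<mu> \<omega>] in \<open>meson le_less_trans less_imp_le\<close>)
  qed
  moreover have "AE \<omega> in uniform01. \<omega> \<in> {0<..<1} \<and> isCont (quantile M) \<omega>"
  proof (rule AE_I')
    have "countable ?D"
      by (rule mono_on_ctble_discont_open[OF _ quantile_mono[OF M]]) simp
    then show "?D \<in> null_sets uniform01"
      unfolding uniform01_def
      by (subst null_sets_restrict_space) (auto intro: countable_imp_null_set_lborel)
  qed auto
  ultimately show ?thesis
    by (auto elim: eventually_mono)
qed

text \<open>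
  The dominating function may vary with \<open>n\<close> as long as its integrals converge to a finite limit.
  Cutting off at \<open>G'\<close> reduces this to a fixed dominating function: the part of \<open>f n\<close> above \<open>G'\<close> is
  at most the part of \<open>G n\<close> above \<open>G'\<close>, whose integral tends to 0.
\<close>

lemma nn_integral_generalized_dominated_convergence:
  fixes f G :: "nat \<Rightarrow> 'a \<Rightarrow> ennreal"
  assumes [measurable]: "\<And>n. f n \<in> borel_measurable M" "f' \<in> borel_measurable M"
      "\<And>n. G n \<in> borel_measurable M" "G' \<in> borel_measurable M"
    and f: "AE x in M. (\<lambda>n. f n x) \<longlonglongrightarrow> f' x"
    and G: "AE x in M. (\<lambda>n. G n x) \<longlonglongrightarrow> G' x"
    and le: "\<And>n x. f n x \<le> G n x"
    and int: "(\<lambda>n. \<integral>\<^sup>+x. G n x \<partial>M) \<longlonglongrightarrow> (\<integral>\<^sup>+x. G' x \<partial>M)" "(\<integral>\<^sup>+x. G' x \<partial>M) < \<infinity>"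
  shows "(\<lambda>n. \<integral>\<^sup>+x. f n x \<partial>M) \<longlonglongrightarrow> (\<integral>\<^sup>+x. f' x \<partial>M)"
proof (rule tendsto_sandwich)
  have "AE x in M. (\<lambda>n. min (f n x) (G' x)) \<longlonglongrightarrow> f' x"
    using f G
  proof eventually_elim
    case (elim x)
    then have "f' x \<le> G' x"
      by (rule LIMSEQ_le) (use le in auto)
    with tendsto_min[OF elim(1) tendsto_const, of "G' x"] show ?case
      by (simp add: min_absorb1)
  qed
  then show f_lim: "(\<lambda>n. \<integral>\<^sup>+x. min (f n x) (G' x) \<partial>M) \<longlonglongrightarrow> (\<integral>\<^sup>+x. f' x \<partial>M)"
    by (intro nn_integral_dominated_convergence[where w = G'] int) auto
  have "AE x in M. (\<lambda>n. min (G n x) (G' x)) \<longlonglongrightarrow> G' x"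
    using G
  proof eventually_elim
    case (elim x)
    from tendsto_min[OF this tendsto_const, of "G' x"] show ?case by simp
  qed
  then have "(\<lambda>n. \<integral>\<^sup>+x. min (G n x) (G' x) \<partial>M) \<longlonglongrightarrow> (\<integral>\<^sup>+x. G' x \<partial>M)"
    by (intro nn_integral_dominated_convergence[where w = G'] int) auto
  with int have "(\<lambda>n. (\<integral>\<^sup>+x. G n x \<partial>M) - (\<integral>\<^sup>+x. min (G n x) (G' x) \<partial>M)) \<longlonglongrightarrow> (\<integral>\<^sup>+x. G' x \<partial>M) - (\<integral>\<^sup>+x. G' x \<partial>M)"
    by (intro tendsto_diff_ennreal) auto
  with int f_lim show "(\<lambda>n. (\<integral>\<^sup>+x. min (f n x) (G' x) \<partial>M)
      + ((\<integral>\<^sup>+x. G n x \<partial>M) - (\<integral>\<^sup>+x. min (G n x) (G' x) \<partial>M))) \<longlonglongrightarrow> (\<integral>\<^sup>+x. f' x \<partial>M)"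
    using tendsto_add[OF f_lim, of _ 0] by simp
  show "\<forall>\<^sub>F n in sequentially. (\<integral>\<^sup>+x. min (f n x) (G' x) \<partial>M) \<le> (\<integral>\<^sup>+x. f n x \<partial>M)"
    by (auto intro!: always_eventually nn_integral_mono)
  have "(\<integral>\<^sup>+x. f n x \<partial>M) \<le> (\<integral>\<^sup>+x. min (f n x) (G' x) \<partial>M)
      + ((\<integral>\<^sup>+x. G n x \<partial>M) - (\<integral>\<^sup>+x. min (G n x) (G' x) \<partial>M))" for n
  proof -
    have "(\<integral>\<^sup>+x. f n x \<partial>M) \<le> (\<integral>\<^sup>+x. min (f n x) (G' x) + (G n x - min (G n x) (G' x)) \<partial>M)"
    proof (rule nn_integral_mono)
      fix x
      show "f n x \<le> min (f n x) (G' x) + (G n x - min (G n x) (G' x))"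
      proof (cases "f n x \<le> G' x")
        case False
        with le[of n x] have "G' x \<le> G n x" by auto
        then have "G' x + (G n x - G' x) = G n x"
          by (simp add: add.commute diff_add_cancel_ennreal)
        moreover have "min (f n x) (G' x) = G' x" "min (G n x) (G' x) = G' x"
          using False \<open>G' x \<le> G n x\<close> by (auto simp: min_def)
        ultimately show ?thesis
          using le[of n x] by (simp only:)
      qed (simp add: min_def)
    qed
    also have "\<dots> = (\<integral>\<^sup>+x. min (f n x) (G' x) \<partial>M) + (\<integral>\<^sup>+x. G n x - min (G n x) (G' x) \<partial>M)"
      by (rule nn_integral_add) auto
    also have "(\<integral>\<^sup>+x. G n x - min (G n x) (G' x) \<partial>M) = (\<integral>\<^sup>+x. G n x \<partial>M) - (\<integral>\<^sup>+x. min (G n x) (G' x) \<partial>M)"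
    proof (rule nn_integral_diff)
      have "(\<integral>\<^sup>+x. min (G n x) (G' x) \<partial>M) \<le> (\<integral>\<^sup>+x. G' x \<partial>M)"
        by (rule nn_integral_mono) simp
      with int(2) show "(\<integral>\<^sup>+x. min (G n x) (G' x) \<partial>M) \<noteq> \<infinity>" by auto
    qed auto
    finally show ?thesis .
  qed
  then show "\<forall>\<^sub>F n in sequentially. (\<integral>\<^sup>+x. f n x \<partial>M) \<le> (\<integral>\<^sup>+x. min (f n x) (G' x) \<partial>M)
      + ((\<integral>\<^sup>+x. G n x \<partial>M) - (\<integral>\<^sup>+x. min (G n x) (G' x) \<partial>M))"
    by simp
qed

text \<open>
  Convergence of the costs of \<open>W n\<close> survives subtraction of a fixed variable \<open>V\<close> of finite cost,
  since the growth condition provides the dominating functions \<open>A + B * (g (W n) + g V)\<close>, whose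
  integrals converge.
\<close>

lemma cost_tendsto_of_shift:
  fixes g :: "real \<Rightarrow> real"
  assumes P: "prob_space P" and cont: "continuous_on UNIV g" and nonneg: "\<And>x. 0 \<le> g x"
    and A: "0 \<le> A" and B: "0 \<le> B" and growth: "\<And>x y. g (x - y) \<le> A + B * (g x + g y)"
    and [measurable]: "\<And>n. W n \<in> borel_measurable P" "W' \<in> borel_measurable P" "V \<in> borel_measurable P"
    and W: "AE \<omega> in P. (\<lambda>n. W n \<omega>) \<longlonglongrightarrow> W' \<omega>"
    and lim: "(\<lambda>n. \<integral>\<^sup>+\<omega>. ennreal (g (W n \<omega>)) \<partial>P) \<longlonglongrightarrow> (\<integral>\<^sup>+\<omega>. ennreal (g (W' \<omega>)) \<partial>P)"
    and fin: "(\<integral>\<^sup>+\<omega>. ennreal (g (W' \<omega>)) \<partial>P) < \<infinity>" "(\<integral>\<^sup>+\<omega>. ennreal (g (V \<omega>)) \<partial>P) < \<infinity>"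
  shows "(\<lambda>n. \<integral>\<^sup>+\<omega>. ennreal (g (W n \<omega> - V \<omega>)) \<partial>P) \<longlonglongrightarrow> (\<integral>\<^sup>+\<omega>. ennreal (g (W' \<omega> - V \<omega>)) \<partial>P)"
proof -
  interpret prob_space P by fact
  have [measurable]: "g \<in> borel_measurable borel"
    by (rule borel_measurable_continuous_onI[OF cont])
  have tendsto_g: "(\<lambda>n. g (u n)) \<longlonglongrightarrow> g l" if "u \<longlonglongrightarrow> l" for u l
    using continuous_on_tendsto_compose[OF cont that] by simp
  have int: "(\<integral>\<^sup>+\<omega>. ennreal (A + B * (g (Z \<omega>) + g (V \<omega>))) \<partial>P)
      = ennreal A + ennreal B * ((\<integral>\<^sup>+\<omega>. ennreal (g (Z \<omega>)) \<partial>P) + (\<integral>\<^sup>+\<omega>. ennreal (g (V \<omega>)) \<partial>P))"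
    if [measurable]: "Z \<in> borel_measurable P" for Z
  proof -
    have "ennreal (A + B * (g x + g y)) = ennreal A + ennreal B * (ennreal (g x) + ennreal (g y))" for x y
      using A B nonneg by (simp add: ennreal_mult)
    then show ?thesis
      by (simp add: nn_integral_add nn_integral_cmult emeasure_space_1)
  qed
  show ?thesis
  proof (rule nn_integral_generalized_dominated_convergence
      [where G = "\<lambda>n \<omega>. ennreal (A + B * (g (W n \<omega>) + g (V \<omega>)))"
        and G' = "\<lambda>\<omega>. ennreal (A + B * (g (W' \<omega>) + g (V \<omega>)))"])
    show "AE \<omega> in P. (\<lambda>n. ennreal (g (W n \<omega> - V \<omega>))) \<longlonglongrightarrow> ennreal (g (W' \<omega> - V \<omega>))"
      using W by eventually_elim (intro tendsto_ennrealI tendsto_g tendsto_intros)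
    show "AE \<omega> in P. (\<lambda>n. ennreal (A + B * (g (W n \<omega>) + g (V \<omega>)))) \<longlonglongrightarrow> ennreal (A + B * (g (W' \<omega>) + g (V \<omega>)))"
      using W by eventually_elim (intro tendsto_ennrealI tendsto_g tendsto_intros)
    show "(\<lambda>n. \<integral>\<^sup>+\<omega>. ennreal (A + B * (g (W n \<omega>) + g (V \<omega>))) \<partial>P)
        \<longlonglongrightarrow> (\<integral>\<^sup>+\<omega>. ennreal (A + B * (g (W' \<omega>) + g (V \<omega>))) \<partial>P)"
      by (subst (1 2) int) (auto intro!: tendsto_add tendsto_const ennreal_tendsto_cmult lim)
    show "(\<integral>\<^sup>+\<omega>. ennreal (A + B * (g (W' \<omega>) + g (V \<omega>))) \<partial>P) < \<infinity>"
      by (subst int) (use fin in \<open>auto simp: ennreal_mult_less_top\<close>)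
    show "ennreal (g (W n \<omega> - V \<omega>)) \<le> ennreal (A + B * (g (W n \<omega>) + g (V \<omega>)))" for n \<omega>
      by (intro ennreal_leI growth)
  qed measurable
qed

text \<open>
  Convexity along the segment from \<open>0\<close> to \<open>t\<close> shows that outside \<open>[-\<epsilon>, \<epsilon>]\<close> the function grows at
  least linearly, with a slope given by its values at \<open>\<epsilon>\<close> and \<open>-\<epsilon>\<close>.
\<close>

lemma convex_positive_linear_growth:
  fixes g :: "real \<Rightarrow> real"
  assumes g: "convex_on UNIV g" "g 0 = 0" and pos: "\<And>x. x \<noteq> 0 \<Longrightarrow> 0 < g x" and "0 < \<epsilon>"
  obtains C where "0 \<le> C" "\<And>t. \<bar>t\<bar> \<le> \<epsilon> + C * g t"
proof -
  define m where "m = min (g \<epsilon>) (g (- \<epsilon>))"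
  have "0 < m"
    using pos[of \<epsilon>] pos[of "- \<epsilon>"] \<open>0 < \<epsilon>\<close> by (simp add: m_def)
  have "\<bar>t\<bar> \<le> \<epsilon> + \<epsilon> / m * g t" for t
  proof (cases "\<bar>t\<bar> \<le> \<epsilon>")
    case True
    have "0 \<le> g t"
      using pos[of t] g(2) by (cases "t = 0") auto
    with True \<open>0 < m\<close> \<open>0 < \<epsilon>\<close> show ?thesis
      by (intro order_trans[OF True]) simp
  next
    case False
    \<comment> \<open>The factor that scales \<open>t\<close> to \<open>\<epsilon>\<close> or \<open>- \<epsilon>\<close>.\<close>
    define l where "l = \<epsilon> / \<bar>t\<bar>"
    have l: "0 \<le> l" "l \<le> 1" "l * t = \<epsilon> \<or> l * t = - \<epsilon>"
      using False \<open>0 < \<epsilon>\<close> by (auto simp: l_def abs_if field_simps)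
    have "m \<le> g (l * t)"
      using l(3) by (auto simp: m_def)
    also have "\<dots> \<le> l * g t"
      using convex_onD[OF g(1) l(1,2), of 0 t] g(2) by simp
    finally have "m * \<bar>t\<bar> \<le> \<epsilon> * g t"
      using False \<open>0 < \<epsilon>\<close> by (simp add: l_def field_simps)
    then have "\<bar>t\<bar> \<le> \<epsilon> / m * g t"
      using \<open>0 < m\<close> by (simp add: field_simps)
    with \<open>0 < \<epsilon>\<close> show ?thesis by simp
  qed
  with \<open>0 < m\<close> \<open>0 < \<epsilon>\<close> that[of "\<epsilon> / m"] show ?thesis by simp
qed

text \<open>
  A cost that is positive away from 0 controls the absolute value up to an arbitrarily small
  additive constant, by \<open>convex_positive_linear_growth\<close>.
\<close>

lemma L1_tendsto_of_cost_tendsto: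
  fixes g :: "real \<Rightarrow> real"
  assumes P: "prob_space P"
    and g: "convex_on UNIV g" "g 0 = 0" and pos: "\<And>x. x \<noteq> 0 \<Longrightarrow> 0 < g x"
    and [measurable]: "\<And>n. Z n \<in> borel_measurable P"
    and lim: "(\<lambda>n. \<integral>\<^sup>+\<omega>. ennreal (g (Z n \<omega>)) \<partial>P) \<longlonglongrightarrow> 0"
  shows "(\<lambda>n. \<integral>\<^sup>+\<omega>. ennreal \<bar>Z n \<omega>\<bar> \<partial>P) \<longlonglongrightarrow> 0"
proof (rule order_tendstoI)
  interpret prob_space P by fact
  fix e :: ennreal assume "0 < e"
  then obtain \<epsilon> where \<epsilon>: "0 < \<epsilon>" "ennreal \<epsilon> < e"
  proof (cases e)
    case (real r)
    with \<open>0 < e\<close> that[of "r / 2"] show ?thesis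
      by (auto simp: ennreal_less_iff)
  qed (use that[of 1] in auto)
  have [measurable]: "g \<in> borel_measurable borel"
    by (intro borel_measurable_continuous_onI convex_on_continuous g) auto
  have nonneg: "0 \<le> g x" for x
    using pos[of x] g(2) by (cases "x = 0") auto
  obtain C where C: "0 \<le> C" "\<And>t. \<bar>t\<bar> \<le> \<epsilon> + C * g t"
    using convex_positive_linear_growth[OF g pos \<epsilon>(1)] by blast
  have bound: "(\<integral>\<^sup>+\<omega>. ennreal \<bar>Z n \<omega>\<bar> \<partial>P) \<le> ennreal \<epsilon> + ennreal C * (\<integral>\<^sup>+\<omega>. ennreal (g (Z n \<omega>)) \<partial>P)" for n
  proof -
    have "(\<integral>\<^sup>+\<omega>. ennreal \<bar>Z n \<omega>\<bar> \<partial>P) \<le> (\<integral>\<^sup>+\<omega>. ennreal (\<epsilon> + C * g (Z n \<omega>)) \<partial>P)"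
      by (intro nn_integral_mono ennreal_leI C)
    also have "\<dots> = (\<integral>\<^sup>+\<omega>. ennreal \<epsilon> + ennreal C * ennreal (g (Z n \<omega>)) \<partial>P)"
      using \<epsilon> C nonneg by (intro nn_integral_cong) (simp add: ennreal_plus ennreal_mult)
    also have "\<dots> = ennreal \<epsilon> + ennreal C * (\<integral>\<^sup>+\<omega>. ennreal (g (Z n \<omega>)) \<partial>P)"
      by (subst nn_integral_add) (auto simp: nn_integral_cmult emeasure_space_1)
    finally show ?thesis .
  qed
  have "(\<lambda>n. ennreal \<epsilon> + ennreal C * (\<integral>\<^sup>+\<omega>. ennreal (g (Z n \<omega>)) \<partial>P)) \<longlonglongrightarrow> ennreal \<epsilon> + ennreal C * 0"
    by (intro tendsto_add tendsto_const ennreal_tendsto_cmult lim) simp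
  then have "\<forall>\<^sub>F n in sequentially. ennreal \<epsilon> + ennreal C * (\<integral>\<^sup>+\<omega>. ennreal (g (Z n \<omega>)) \<partial>P) < e"
    using \<epsilon>(2) by (intro order_tendstoD) auto
  then show "\<forall>\<^sub>F n in sequentially. (\<integral>\<^sup>+\<omega>. ennreal \<bar>Z n \<omega>\<bar> \<partial>P) < e"
    by eventually_elim (rule le_less_trans[OF bound])
qed simp

lemma cts_step_lipschitz:
  assumes "a < b"
  shows "\<bar>cts_step a b x - cts_step a b y\<bar> \<le> \<bar>x - y\<bar> / (b - a)"
proof -
  \<comment> \<open>Clamping to \<open>[0, 1]\<close> does not increase distances, so the affine function decides.\<close>
  have eq: "cts_step a b z = max 0 (min 1 ((b - z) / (b - a)))" for z
    using assms by (auto simp: cts_step_def max_def min_def field_simps)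
  have "\<bar>max 0 (min 1 u) - max 0 (min 1 v)\<bar> \<le> \<bar>u - v\<bar>" for u v :: real
    by auto
  then have "\<bar>cts_step a b x - cts_step a b y\<bar> \<le> \<bar>(b - x) / (b - a) - (b - y) / (b - a)\<bar>"
    unfolding eq .
  also have "\<dots> = \<bar>x - y\<bar> / (b - a)"
    using assms by (simp add: diff_divide_distrib[symmetric] abs_minus_commute)
  finally show ?thesis .
qed

text \<open>
  Weak convergence only has to be tested on the functions \<open>cts_step a b\<close>, which are Lipschitz.
\<close>

lemma L1_tendsto_imp_weak_conv:
  assumes P: "prob_space P"
    and X[measurable]: "\<And>n. X n \<in> borel_measurable P" "X' \<in> borel_measurable P"
    and lim: "(\<lambda>n. \<integral>\<^sup>+\<omega>. ennreal \<bar>X n \<omega> - X' \<omega>\<bar> \<partial>P) \<longlonglongrightarrow> 0"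
  shows "weak_conv_m (\<lambda>n. distr P borel (X n)) (distr P borel X')"
proof (rule integral_cts_step_conv_imp_weak_conv)
  interpret prob_space P by fact
  show "real_distribution (distr P borel (X n))" for n by simp
  show "real_distribution (distr P borel X')" by simp
  fix a b :: real assume ab: "a < b"
  have [measurable]: "cts_step a b \<in> borel_measurable borel"
    using cts_step_uniformly_continuous[OF ab]
    by (intro borel_measurable_continuous_onI uniformly_continuous_imp_continuous)
  have int: "integrable P (\<lambda>\<omega>. cts_step a b (Z \<omega>))" if [measurable]: "Z \<in> borel_measurable P" for Z
    by (rule integrable_const_bound[where B = 1]) (use ab in \<open>auto simp: cts_step_def\<close>)
  have bound: "ennreal \<bar>(\<integral>\<omega>. cts_step a b (X n \<omega>) \<partial>P) - (\<integral>\<omega>. cts_step a b (X' \<omega>) \<partial>P)\<bar>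
      \<le> ennreal (1 / (b - a)) * (\<integral>\<^sup>+\<omega>. ennreal \<bar>X n \<omega> - X' \<omega>\<bar> \<partial>P)" for n
  proof -
    have "ennreal \<bar>(\<integral>\<omega>. cts_step a b (X n \<omega>) \<partial>P) - (\<integral>\<omega>. cts_step a b (X' \<omega>) \<partial>P)\<bar>
      = ennreal (norm (\<integral>\<omega>. cts_step a b (X n \<omega>) - cts_step a b (X' \<omega>) \<partial>P))"
      by (simp add: int)
    also have "\<dots> \<le> (\<integral>\<^sup>+\<omega>. ennreal (norm (cts_step a b (X n \<omega>) - cts_step a b (X' \<omega>))) \<partial>P)"
      by (intro integral_norm_bound_ennreal Bochner_Integration.integrable_diff int) auto
    also have "\<dots> \<le> (\<integral>\<^sup>+\<omega>. ennreal (1 / (b - a)) * ennreal \<bar>X n \<omega> - X' \<omega>\<bar> \<partial>P)"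
      using cts_step_lipschitz[OF ab] ab
      by (intro nn_integral_mono) (simp add: ennreal_mult[symmetric] ennreal_leI)
    also have "\<dots> = ennreal (1 / (b - a)) * (\<integral>\<^sup>+\<omega>. ennreal \<bar>X n \<omega> - X' \<omega>\<bar> \<partial>P)"
      by (rule nn_integral_cmult) measurable
    finally show ?thesis .
  qed
  have "(\<lambda>n. ennreal (1 / (b - a)) * (\<integral>\<^sup>+\<omega>. ennreal \<bar>X n \<omega> - X' \<omega>\<bar> \<partial>P)) \<longlonglongrightarrow> ennreal (1 / (b - a)) * 0"
    by (intro ennreal_tendsto_cmult lim) simp
  then have upper: "(\<lambda>n. ennreal (1 / (b - a)) * (\<integral>\<^sup>+\<omega>. ennreal \<bar>X n \<omega> - X' \<omega>\<bar> \<partial>P)) \<longlonglongrightarrow> 0"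
    by simp
  have "(\<lambda>n. ennreal \<bar>(\<integral>\<omega>. cts_step a b (X n \<omega>) \<partial>P) - (\<integral>\<omega>. cts_step a b (X' \<omega>) \<partial>P)\<bar>) \<longlonglongrightarrow> 0"
    by (rule tendsto_sandwich[OF always_eventually always_eventually tendsto_const upper]) (use bound in simp_all)
  then have "(\<lambda>n. \<bar>(\<integral>\<omega>. cts_step a b (X n \<omega>) \<partial>P) - (\<integral>\<omega>. cts_step a b (X' \<omega>) \<partial>P)\<bar>) \<longlonglongrightarrow> 0"
    by (subst (asm) ennreal_tendsto_0_iff) auto
  then show "(\<lambda>n. \<integral>x. cts_step a b x \<partial>distr P borel (X n)) \<longlonglongrightarrow> (\<integral>x. cts_step a b x \<partial>distr P borel X')"
    by (subst (1 2) integral_distr) (auto simp: tendsto_rabs_zero_iff LIM_zero_iff)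
qed

section \<open>Convergence of transportation costs\<close>

theorem theorem7:
  fixes g :: "real \<Rightarrow> real"
    and \<mu> :: "nat \<Rightarrow> real measure"
    and \<mu>' :: "real measure"
  assumes g_convex: "strictly_convex_on UNIV g"
    and g_min: "\<And>x. g 0 \<le> g x"
    and g_zero: "g 0 = 0"
    and g_growth: "\<exists>A\<ge>0. \<exists>B\<ge>0. \<forall>x y. g (x - y) \<le> A + B * (g x + g y)"
    and \<mu>_distr: "\<And>n. real_distribution (\<mu> n)"
    and \<mu>'_distr: "real_distribution \<mu>'"
  defines "J \<equiv> transport_cost g"
  defines "cond1 \<equiv> weak_conv_m \<mu> \<mu>' \<and>
      (\<forall>\<nu>. real_distribution \<nu> \<longrightarrow> (\<lambda>n. J (\<mu> n) \<nu>) \<longlonglongrightarrow> J \<mu>' \<nu>)"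
    and "cond2 \<equiv> weak_conv_m \<mu> \<mu>' \<and>
      (\<exists>\<nu>\<^sub>0. real_distribution \<nu>\<^sub>0 \<and> (\<lambda>n. J (\<mu> n) \<nu>\<^sub>0) \<longlonglongrightarrow> J \<mu>' \<nu>\<^sub>0 \<and> J \<mu>' \<nu>\<^sub>0 < \<infinity>)"
    and "cond3 \<equiv> (\<lambda>n. J (\<mu> n) \<mu>') \<longlonglongrightarrow> 0"
  shows "(cond1 \<longleftrightarrow> cond2) \<and> (cond2 \<longleftrightarrow> cond3)"
proof -
  have convex: "convex_on UNIV g"
    by (rule strictly_convex_on_imp_convex_on[OF g_convex])
  have cont: "continuous_on UNIV g"
    by (rule convex_on_continuous[OF open_UNIV convex])
  have [measurable]: "g \<in> borel_measurable borel"
    by (rule borel_measurable_continuous_onI[OF cont])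
  have nonneg: "0 \<le> g x" for x
    using g_min[of x] g_zero by simp
  have pos: "0 < g x" if "x \<noteq> 0" for x
    using strictly_convex_on_unique_min[OF g_convex g_min that] g_zero by simp
  obtain A B where A: "0 \<le> A" and B: "0 \<le> B" and growth: "\<And>x y. g (x - y) \<le> A + B * (g x + g y)"
    using g_growth by blast
  interpret \<Omega>: prob_space uniform01
    by (rule prob_space_uniform01)
  define X where "X n = quantile (\<mu> n)" for n
  define X' where "X' = quantile \<mu>'"
  have [measurable]: "X n \<in> borel_measurable uniform01" "X' \<in> borel_measurable uniform01" for n
    unfolding X_def X'_def by (rule quantile_measurable \<mu>_distr \<mu>'_distr)+
  have J_eq: "J M N = (\<integral>\<^sup>+\<omega>. ennreal (g (quantile M \<omega> - quantile N \<omega>)) \<partial>uniform01)"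
    if "real_distribution M" "real_distribution N" for M N
    unfolding J_def using that by (intro transport_cost_eq_quantile convex g_zero nonneg)
  have J_seq: "J (\<mu> n) \<nu> = (\<integral>\<^sup>+\<omega>. ennreal (g (X n \<omega> - quantile \<nu> \<omega>)) \<partial>uniform01)"
    and J_lim: "J \<mu>' \<nu> = (\<integral>\<^sup>+\<omega>. ennreal (g (X' \<omega> - quantile \<nu> \<omega>)) \<partial>uniform01)"
    if "real_distribution \<nu>" for n \<nu>
    using that by (simp_all add: J_eq \<mu>_distr \<mu>'_distr X_def X'_def)
  have J_self: "J \<mu>' \<mu>' = 0"
    by (simp add: J_eq \<mu>'_distr g_zero)

  \<comment> \<open>The measure \<open>\<mu>'\<close> itself serves as \<open>\<nu>\<^sub>0\<close>.\<close>
  have "cond1 \<Longrightarrow> cond2"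
    unfolding cond1_def cond2_def using \<mu>'_distr J_self by (auto intro!: exI[of _ \<mu>'])
  moreover have cond3 if "cond2"
  proof -
    from that obtain \<nu> where weak: "weak_conv_m \<mu> \<mu>'" and \<nu>: "real_distribution \<nu>"
      and lim: "(\<lambda>n. J (\<mu> n) \<nu>) \<longlonglongrightarrow> J \<mu>' \<nu>" and fin: "J \<mu>' \<nu> < \<infinity>"
      unfolding cond2_def by blast
    note [measurable] = quantile_measurable[OF \<nu>]
    have AE: "AE \<omega> in uniform01. (\<lambda>n. X n \<omega>) \<longlonglongrightarrow> X' \<omega>"
      unfolding X_def X'_def by (rule quantile_tendsto_AE[OF \<mu>_distr \<mu>'_distr weak])
    \<comment> \<open>Here \<open>X n - X'\<close> is written as a difference of two displacements relative to \<open>\<nu>\<close>, the first of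
      which has converging cost.\<close>
    have "(\<lambda>n. \<integral>\<^sup>+\<omega>. ennreal (g ((X n \<omega> - quantile \<nu> \<omega>) - (X' \<omega> - quantile \<nu> \<omega>))) \<partial>uniform01)
      \<longlonglongrightarrow> (\<integral>\<^sup>+\<omega>. ennreal (g ((X' \<omega> - quantile \<nu> \<omega>) - (X' \<omega> - quantile \<nu> \<omega>))) \<partial>uniform01)"
    proof (rule cost_tendsto_of_shift[OF \<Omega>.prob_space_axioms cont nonneg A B growth])
      show "AE \<omega> in uniform01. (\<lambda>n. X n \<omega> - quantile \<nu> \<omega>) \<longlonglongrightarrow> X' \<omega> - quantile \<nu> \<omega>"
        using AE by eventually_elim (intro tendsto_intros)
    qed (use lim fin in \<open>simp_all add: J_seq J_lim \<nu>\<close>)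
    then show cond3
      unfolding cond3_def by (simp add: J_seq[OF \<mu>'_distr] X'_def[symmetric] g_zero)
  qed
  moreover have cond1 if "cond3"
  proof -
    have lim: "(\<lambda>n. \<integral>\<^sup>+\<omega>. ennreal (g (X n \<omega> - X' \<omega>)) \<partial>uniform01) \<longlonglongrightarrow> 0"
      using that unfolding cond3_def by (simp add: J_seq[OF \<mu>'_distr] X'_def[symmetric])
    have "(\<lambda>n. \<integral>\<^sup>+\<omega>. ennreal \<bar>X n \<omega> - X' \<omega>\<bar> \<partial>uniform01) \<longlonglongrightarrow> 0"
      by (rule L1_tendsto_of_cost_tendsto[OF \<Omega>.prob_space_axioms convex g_zero pos _ lim]) measurable
    then have "weak_conv_m (\<lambda>n. distr uniform01 borel (X n)) (distr uniform01 borel X')"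
      by (intro L1_tendsto_imp_weak_conv \<Omega>.prob_space_axioms) measurable
    then have weak: "weak_conv_m \<mu> \<mu>'"
      by (simp add: X_def X'_def distr_quantile \<mu>_distr \<mu>'_distr)
    have AE: "AE \<omega> in uniform01. (\<lambda>n. X n \<omega>) \<longlonglongrightarrow> X' \<omega>"
      unfolding X_def X'_def by (rule quantile_tendsto_AE[OF \<mu>_distr \<mu>'_distr weak])
    have "(\<lambda>n. J (\<mu> n) \<nu>) \<longlonglongrightarrow> J \<mu>' \<nu>" if \<nu>: "real_distribution \<nu>" for \<nu>
    proof (cases "J \<mu>' \<nu> < \<infinity>")
      case True
      note [measurable] = quantile_measurable[OF \<nu>]
      \<comment> \<open>Now the converging displacement is \<open>X n - X'\<close>, and the fixed one goes from \<open>X'\<close> to the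
        quantile function of \<open>\<nu>\<close>; its cost is finite by the growth condition with \<open>x = 0\<close>.\<close>
      have "(\<lambda>n. \<integral>\<^sup>+\<omega>. ennreal (g ((X n \<omega> - X' \<omega>) - (quantile \<nu> \<omega> - X' \<omega>))) \<partial>uniform01)
        \<longlonglongrightarrow> (\<integral>\<^sup>+\<omega>. ennreal (g (0 - (quantile \<nu> \<omega> - X' \<omega>))) \<partial>uniform01)"
      proof (rule cost_tendsto_of_shift[OF \<Omega>.prob_space_axioms cont nonneg A B growth])
        show "AE \<omega> in uniform01. (\<lambda>n. X n \<omega> - X' \<omega>) \<longlonglongrightarrow> 0"
          using AE by eventually_elim (rule LIM_zero)
        have "(\<integral>\<^sup>+\<omega>. ennreal (g (quantile \<nu> \<omega> - X' \<omega>)) \<partial>uniform01)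
            \<le> (\<integral>\<^sup>+\<omega>. ennreal A + ennreal B * ennreal (g (X' \<omega> - quantile \<nu> \<omega>)) \<partial>uniform01)"
        proof (rule nn_integral_mono)
          fix \<omega>
          have "g (quantile \<nu> \<omega> - X' \<omega>) \<le> A + B * g (X' \<omega> - quantile \<nu> \<omega>)"
            using growth[of 0 "X' \<omega> - quantile \<nu> \<omega>"] g_zero by simp
          then have "ennreal (g (quantile \<nu> \<omega> - X' \<omega>)) \<le> ennreal (A + B * g (X' \<omega> - quantile \<nu> \<omega>))"
            by (rule ennreal_leI)
          then show "ennreal (g (quantile \<nu> \<omega> - X' \<omega>)) \<le> ennreal A + ennreal B * ennreal (g (X' \<omega> - quantile \<nu> \<omega>))"
            using A B nonneg by (simp add: ennreal_mult)
        qed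
        also have "\<dots> = ennreal A + ennreal B * J \<mu>' \<nu>"
          by (simp add: nn_integral_add nn_integral_cmult \<Omega>.emeasure_space_1[simplified] J_lim[OF \<nu>])
        also have "\<dots> < \<infinity>"
          using True by (simp add: ennreal_mult_less_top)
        finally show "(\<integral>\<^sup>+\<omega>. ennreal (g (quantile \<nu> \<omega> - X' \<omega>)) \<partial>uniform01) < \<infinity>" .
      qed (use lim g_zero in simp_all)
      then show ?thesis
        by (simp add: J_seq J_lim \<nu>)
    next
      case False
      note [measurable] = quantile_measurable[OF \<nu>]
      \<comment> \<open>When the limiting cost is infinite, Fatou's lemma suffices.\<close>
      have "J \<mu>' \<nu> = (\<integral>\<^sup>+\<omega>. liminf (\<lambda>n. ennreal (g (X n \<omega> - quantile \<nu> \<omega>))) \<partial>uniform01)"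
        unfolding J_lim[OF \<nu>]
      proof (rule nn_integral_cong_AE)
        show "AE \<omega> in uniform01. ennreal (g (X' \<omega> - quantile \<nu> \<omega>)) = liminf (\<lambda>n. ennreal (g (X n \<omega> - quantile \<nu> \<omega>)))"
          using AE
        proof eventually_elim
          case (elim \<omega>)
          have "(\<lambda>n. ennreal (g (X n \<omega> - quantile \<nu> \<omega>))) \<longlonglongrightarrow> ennreal (g (X' \<omega> - quantile \<nu> \<omega>))"
            by (intro tendsto_ennrealI continuous_on_tendsto_compose[OF cont] tendsto_diff elim tendsto_const) auto
          then show ?case
            by (rule lim_imp_Liminf[OF sequentially_bot, symmetric])
        qed
      qed
      also have "\<dots> \<le> liminf (\<lambda>n. J (\<mu> n) \<nu>)"
        unfolding J_seq[OF \<nu>] by (rule nn_integral_liminf) measurable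
      finally have "liminf (\<lambda>n. J (\<mu> n) \<nu>) = \<infinity>"
        using False by (simp add: top.extremum_unique not_less)
      moreover have "liminf (\<lambda>n. J (\<mu> n) \<nu>) \<le> limsup (\<lambda>n. J (\<mu> n) \<nu>)"
        by (rule Liminf_le_Limsup) simp
      ultimately show ?thesis
        using False by (subst tendsto_iff_Liminf_eq_Limsup) (auto simp: top.extremum_unique not_less)
    qed
    with weak show cond1
      unfolding cond1_def by blast
  qed
  ultimately show ?thesis by blast
qed

end
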